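(* Let $\lambda\in(0,\infty)$, let $f(t)$ be a function defined for $t\ge 0$, and let $$F_{\lambda}(s)=\int_0^{\infty}(1+\lambda t)^{-\frac{s}{\lambda}}f(t)\,dt.$$ For $n\in\mathbb{N}$, and for $s$ suitably restricted to guarantee the convergence of the relevant degenerate Laplace transforms, we have $$\mathcal{L}_{\lambda}\left(\left(\log(1+\lambda t)\right)^n f(t)\right)=(-1)^n\lambda^n\left(\frac{d}{ds}\right)^nF_{\lambda}(s).$$
   Context: For $\lambda\in(0,\infty)$ and a function $g(t)$ defined for $t\ge 0$, the degenerate Laplace transform of $g$ is the function of $s$ given by $$\mathcal{L}_{\lambda}(g(t))=\int_0^{\infty}(1+\lambda t)^{-\frac{s}{\lambda}}g(t)\,dt,$$ if the integral converges. Thus $F_\lambda(s)=\mathcal{L}_\lambda(f(t))$. *)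

theory Defs
  imports "HOL-Complex_Analysis.Complex_Analysis"
begin

text \<open>
  The integral over \<open>[0,\<infinity>)\<close> is the Henstock--Kurzweil integral, which covers both absolutely
  convergent Lebesgue integrals and conditionally convergent improper integrals
  \<open>lim T\<rightarrow>\<infinity> \<integral>\<^sub>0\<^sup>T\<close>.  Functions and the variable \<open>s\<close> are complex; only the
  values of \<open>g\<close> on \<open>t \<ge> 0\<close> matter.  For \<open>lam > 0\<close> the base \<open>1 + lam * t\<close> is a positive real,
  so the principal branch taken by \<open>powr\<close> is the usual power.
\<close>

definition degenerate_kernel :: "real \<Rightarrow> complex \<Rightarrow> real \<Rightarrow> complex" where
  "degenerate_kernel lam s t = complex_of_real (1 + lam * t) powr (- s / complex_of_real lam)"

definition degenerate_laplace_converges :: "real \<Rightarrow> (real \<Rightarrow> complex) \<Rightarrow> complex \<Rightarrow> bool" where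
  "degenerate_laplace_converges lam g s \<longleftrightarrow>
     (\<lambda>t. degenerate_kernel lam s t * g t) integrable_on {0..}"

text \<open>Meaningful only at those \<open>s\<close> where the integral converges; elsewhere the value is \<open>0\<close>.\<close>

definition degenerate_laplace :: "real \<Rightarrow> (real \<Rightarrow> complex) \<Rightarrow> complex \<Rightarrow> complex" where
  "degenerate_laplace lam g s = integral {0..} (\<lambda>t. degenerate_kernel lam s t * g t)"

end

theory Submission
  imports Defs "HOL-Real_Asymp.Real_Asymp"
begin

text \<open>
  Fix \<open>h = degenerate_kernel lam s0 \<cdot> f\<close>, whose integral over \<open>[0,\<infinity>)\<close> converges, possibly only
  conditionally. With \<open>L = ln (1 + lam t)\<close> and \<open>z = s - s0\<close> the transform at \<open>s\<close> of \<open>L ^ k f\<close> is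
  \<open>\<integral> L ^ k exp (- z L / lam) h\<close>. Formally each derivative in \<open>s\<close> brings down a factor
  \<open>- L / lam\<close>, which is the claim; but nothing converges absolutely, so dominated convergence
  does not justify differentiating under the integral sign.

  The remedy is Abel's: integrate by parts against the primitive \<open>H t = \<integral>\<^sub>0\<^sup>t h\<close>, which is
  continuous and bounded. As \<open>h\<close> is only Henstock--Kurzweil integrable, \<open>H\<close> need not be
  differentiable everywhere, and integration by parts comes from Henstock's lemma
  (\<open>has_integral_product_rule\<close>). On \<open>[0,T]\<close> it turns the truncated transform into a boundary term
  minus the integral of a function that is continuous in \<open>t\<close> and entire in \<open>z\<close>, so the truncated
  transforms are entire and may be differentiated under the integral
  (\<open>truncated_transform_higher_deriv\<close>). For \<open>k = 0\<close> it also bounds the tail from \<open>S\<close> onwards by a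
  constant times \<open>(1 + lam S) powr (- Re z / lam)\<close>, so the truncations converge uniformly where
  \<open>Re z\<close> is bounded below and \<open>z\<close> is bounded (\<open>truncated_transform_uniform_limit\<close>).

  Only the case \<open>k = 0\<close> needs an estimate. By Weierstrass's theorem a locally uniform limit of
  holomorphic functions is holomorphic and all derivatives converge to those of the limit. The
  \<open>n\<close>-th derivative of the truncated transform is \<open>(- 1 / lam) ^ n\<close> times the truncated
  transform of \<open>L ^ n f\<close>, so the latter has a limit as \<open>T \<rightarrow> \<infinity>\<close>, and by Hake's theorem
  (\<open>has_integral_atLeast_if_tendsto\<close>) that limit is the transform of \<open>L ^ n f\<close>.
\<close>

section \<open>Integration by parts for the Henstock--Kurzweil integral\<close>

text \<open>
  By Henstock's lemma the Riemann sum of \<open>\<phi> h\<close> is close to the sum of \<open>\<phi> x (H v - H u)\<close> over the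
  cells \<open>[u,v]\<close> with tag \<open>x\<close>, \<open>\<phi>\<close> being bounded. What is left of the increment of \<open>\<phi> H\<close> on a cell is
  the increment of \<open>y \<mapsto> (\<phi> y - \<phi> x) H y\<close>. This function has derivative \<open>\<phi>' x H x\<close> at
  \<open>x\<close> because \<open>H\<close> is continuous there, whether or not \<open>H\<close> is differentiable. The increments of \<open>\<phi> H\<close>
  telescope to the stated value since \<open>H a = 0\<close>.
\<close>

lemma has_integral_product_rule:
  fixes \<phi> \<phi>' h :: "real \<Rightarrow> 'a::{real_normed_algebra, euclidean_space}"
  assumes ab: "a \<le> b" and h: "h integrable_on {a..b}"
    and \<phi>: "\<And>x. x \<in> {a..b} \<Longrightarrow> (\<phi> has_vector_derivative \<phi>' x) (at x within {a..b})"
  defines "H \<equiv> \<lambda>x. integral {a..x} h"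
  shows "((\<lambda>x. \<phi> x * h x + \<phi>' x * H x) has_integral \<phi> b * H b) {a..b}"
  unfolding has_integral_real
proof (intro allI impI)
  fix e :: real assume e: "e > 0"
  have cont_H: "continuous_on {a..b} H"
    unfolding H_def by (rule indefinite_integral_continuous_1[OF h])
  have "continuous_on {a..b} \<phi>"
    using \<phi> has_vector_derivative_continuous continuous_on_eq_continuous_within by blast
  then have "bounded (\<phi> ` {a..b})"
    by (intro compact_imp_bounded compact_continuous_image) auto
  then obtain B where B: "B > 0" "\<And>x. x \<in> {a..b} \<Longrightarrow> norm (\<phi> x) \<le> B"
    unfolding bounded_pos by auto
  \<comment> \<open>\<open>B * e1\<close> pays for Henstock's lemma and \<open>e2 * (b - a)\<close> for the linearisation of \<open>\<psi>\<close>; the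
    summand \<open>1\<close> in \<open>e2\<close> covers \<open>a = b\<close>.\<close>
  define e1 where "e1 = e / (2 * B)"
  define e2 where "e2 = e / (2 * (b - a + 1))"
  have e1: "e1 > 0" and e2: "e2 > 0" using e B ab by (auto simp: e1_def e2_def)
  define \<psi> where "\<psi> = (\<lambda>x y. (\<phi> y - \<phi> x) * H y)"
  have \<psi>: "(\<psi> x has_vector_derivative \<phi>' x * H x) (at x within {a..b})" if x: "x \<in> {a..b}" for x
  proof -
    let ?F = "at x within {a..b}"
    let ?r = "\<lambda>y. (1 / norm (y - x)) *\<^sub>R (\<phi> y - (\<phi> x + (y - x) *\<^sub>R \<phi>' x))"
    let ?q = "\<lambda>y. ((y - x) / norm (y - x)) *\<^sub>R (\<phi>' x * (H y - H x))"
    have H: "(H \<longlongrightarrow> H x) ?F" using cont_H x by (auto simp: continuous_on_def)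
    have "(?r \<longlongrightarrow> 0) ?F"
      using \<phi>[OF x] by (simp add: has_vector_derivative_def has_derivative_within)
    then have "((\<lambda>y. ?r y * H y) \<longlongrightarrow> 0 * H x) ?F" by (intro tendsto_mult H)
    moreover have "(?q \<longlongrightarrow> 0) ?F"
    proof (rule Lim_null_comparison)
      show "eventually (\<lambda>y. norm (?q y) \<le> norm (\<phi>' x * (H y - H x))) ?F" by simp
      show "((\<lambda>y. norm (\<phi>' x * (H y - H x))) \<longlongrightarrow> 0) ?F"
        by (rule tendsto_eq_intros H | simp)+
    qed
    ultimately have "((\<lambda>y. ?r y * H y + ?q y) \<longlongrightarrow> 0) ?F"
      using tendsto_add by fastforce
    moreover have "?r y * H y + ?q y = (1 / norm (y - x)) *\<^sub>R
        (\<psi> x y - (\<psi> x x + (y - x) *\<^sub>R (\<phi>' x * H x)))" for y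
    proof -
      have "(\<phi> y - (\<phi> x + (y - x) *\<^sub>R \<phi>' x)) * H y + (y - x) *\<^sub>R (\<phi>' x * (H y - H x))
          = \<psi> x y - (\<psi> x x + (y - x) *\<^sub>R (\<phi>' x * H x))"
        by (simp add: \<psi>_def algebra_simps)
      moreover have "?r y * H y + ?q y = (1 / norm (y - x)) *\<^sub>R
          ((\<phi> y - (\<phi> x + (y - x) *\<^sub>R \<phi>' x)) * H y + (y - x) *\<^sub>R (\<phi>' x * (H y - H x)))"
        by (simp add: scaleR_add_right)
      ultimately show ?thesis by simp
    qed
    ultimately show ?thesis
      unfolding has_vector_derivative_def has_derivative_within
      by (simp add: bounded_linear_scaleR_left)
  qed
  have "\<forall>x. \<exists>d>0. x \<in> {a..b} \<longrightarrow>
      (\<forall>y\<in>{a..b}. norm (y - x) < d \<longrightarrow>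
         norm (\<psi> x y - \<psi> x x - (y - x) *\<^sub>R (\<phi>' x * H x)) \<le> e2 * norm (y - x))"
    (is "\<forall>x. \<exists>d>0. ?Q x d")
    using \<psi>[unfolded has_vector_derivative_def has_derivative_within_alt] e2 by blast
  then obtain d where "\<forall>x. d x > 0 \<and> ?Q x (d x)"
    using choice[of "\<lambda>x d. d > 0 \<and> ?Q x d"] by blast
  then have d: "\<And>x. d x > 0"
    "\<And>x y. \<lbrakk>x \<in> {a..b}; y \<in> {a..b}; norm (y - x) < d x\<rbrakk> \<Longrightarrow>
       norm (\<psi> x y - \<psi> x x - (y - x) *\<^sub>R (\<phi>' x * H x)) \<le> e2 * norm (y - x)"
    by blast+
  obtain \<gamma> where \<gamma>: "gauge \<gamma>"
    "\<And>p. \<lbrakk>p tagged_partial_division_of cbox a b; \<gamma> fine p\<rbrakk> \<Longrightarrow>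
       (\<Sum>(x,K)\<in>p. norm (measure lborel K *\<^sub>R h x - integral K h)) < e1"
    using Henstock_lemma[of h a b e1] h e1 unfolding box_real by blast
  show "\<exists>\<gamma>. gauge \<gamma> \<and> (\<forall>p. p tagged_division_of {a..b} \<and> \<gamma> fine p \<longrightarrow>
      norm ((\<Sum>(x,K)\<in>p. measure lborel K *\<^sub>R (\<phi> x * h x + \<phi>' x * H x)) - \<phi> b * H b) < e)"
  proof (rule exI[of _ "\<lambda>x. \<gamma> x \<inter> ball x (d x)"], intro conjI allI impI)
    show "gauge (\<lambda>x. \<gamma> x \<inter> ball x (d x))"
      by (intro gauge_Int \<gamma>(1) gauge_ball_dependent allI d(1))
    fix p assume "p tagged_division_of {a..b} \<and> (\<lambda>x. \<gamma> x \<inter> ball x (d x)) fine p"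
    then have p: "p tagged_division_of {a..b}" and fine: "(\<lambda>x. \<gamma> x \<inter> ball x (d x)) fine p"
      by auto
    have fine1: "\<gamma> fine p" and fine2: "(\<lambda>x. ball x (d x)) fine p"
      using fine by (auto simp: fine_Int)
    define P where "P = (\<lambda>x. \<phi> x * H x)"
    have Pa: "P a = 0" by (simp add: P_def H_def)
    have tele: "(\<Sum>(x,K)\<in>p. P (Sup K) - P (Inf K)) = \<phi> b * H b"
      using additive_tagged_division_1[OF ab p, of P] Pa by (simp add: P_def)
    have len: "(\<Sum>(x,K)\<in>p. Sup K - Inf K) = b - a"
      using additive_tagged_division_1[OF ab p, of "\<lambda>x. x"] by simp
    have cell: "norm (measure lborel K *\<^sub>R (\<phi> x * h x + \<phi>' x * H x) - (P (Sup K) - P (Inf K)))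
        \<le> B * norm (measure lborel K *\<^sub>R h x - integral K h) + e2 * (Sup K - Inf K)"
      if xK: "(x, K) \<in> p" for x K
    proof -
      obtain u v where K: "K = {u..v}"
        using tagged_division_ofD(4)[OF p xK] by auto
      have xin: "x \<in> K" and Ksub: "K \<subseteq> {a..b}"
        using tagged_division_ofD(2,3)[OF p xK] by auto
      have uv: "u \<le> x" "x \<le> v" "x \<in> {a..b}" "u \<in> {a..b}" "v \<in> {a..b}"
        using xin Ksub by (auto simp: K)
      have "K \<subseteq> ball x (d x)" using fine2 xK by (auto simp: fine_def)
      moreover have "u \<in> K" "v \<in> K" using uv by (auto simp: K)
      ultimately have uvd: "norm (u - x) < d x" "norm (v - x) < d x"
        by (auto simp: dist_norm norm_minus_commute subset_iff)
      have HK: "integral K h = H v - H u"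
      proof -
        have "integral {a..u} h + integral {u..v} h = integral {a..v} h"
          using uv by (intro Henstock_Kurzweil_Integration.integral_combine
              integrable_on_subinterval[OF h]) auto
        then show ?thesis by (simp add: H_def K algebra_simps)
      qed
      define R where "R = (\<lambda>y. \<psi> x y - \<psi> x x - (y - x) *\<^sub>R (\<phi>' x * H x))"
      have split: "measure lborel K *\<^sub>R (\<phi> x * h x + \<phi>' x * H x) - (P (Sup K) - P (Inf K)) =
          \<phi> x * (measure lborel K *\<^sub>R h x - integral K h) + (R u - R v)"
        using uv unfolding HK R_def P_def \<psi>_def by (simp add: K algebra_simps)
      have "norm (\<phi> x * (measure lborel K *\<^sub>R h x - integral K h)) \<le> B * norm (measure lborel K *\<^sub>R h x - integral K h)"
        by (rule order_trans[OF norm_mult_ineq]) (intro mult_right_mono B uv norm_ge_zero)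
      moreover have "norm (R u - R v) \<le> e2 * norm (u - x) + e2 * norm (v - x)"
        unfolding R_def by (intro order_trans[OF norm_triangle_ineq4] add_mono d uv uvd)
      moreover have "e2 * norm (u - x) + e2 * norm (v - x) = e2 * (Sup K - Inf K)"
        using uv by (simp add: K algebra_simps)
      ultimately show ?thesis
        unfolding split using norm_triangle_ineq[of "\<phi> x * (measure lborel K *\<^sub>R h x - integral K h)" "R u - R v"]
        by linarith
    qed
    have "norm ((\<Sum>(x,K)\<in>p. measure lborel K *\<^sub>R (\<phi> x * h x + \<phi>' x * H x)) - \<phi> b * H b)
        = norm (\<Sum>(x,K)\<in>p. measure lborel K *\<^sub>R (\<phi> x * h x + \<phi>' x * H x) - (P (Sup K) - P (Inf K)))"
      unfolding tele[symmetric] by (simp add: sum_subtractf case_prod_unfold)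
    also have "\<dots> \<le> (\<Sum>(x,K)\<in>p. B * norm (measure lborel K *\<^sub>R h x - integral K h) + e2 * (Sup K - Inf K))"
      using cell by (intro sum_norm_le) auto
    also have "\<dots> = B * (\<Sum>(x,K)\<in>p. norm (measure lborel K *\<^sub>R h x - integral K h)) + e2 * (b - a)"
      unfolding len[symmetric] by (simp add: sum.distrib sum_distrib_left case_prod_unfold)
    also have "\<dots> < B * e1 + e2 * (b - a + 1)"
    proof (rule add_less_le_mono)
      have "p tagged_partial_division_of cbox a b"
        using p by (simp add: tagged_division_of_def)
      then show "B * (\<Sum>(x,K)\<in>p. norm (measure lborel K *\<^sub>R h x - integral K h)) < B * e1"
        using \<gamma>(2) fine1 B by simp
      show "e2 * (b - a) \<le> e2 * (b - a + 1)" using e2 by simp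
    qed
    also have "\<dots> = e" using B ab by (simp add: e1_def e2_def field_simps)
    finally show "norm ((\<Sum>(x,K)\<in>p. measure lborel K *\<^sub>R (\<phi> x * h x + \<phi>' x * H x)) - \<phi> b * H b) < e" .
  qed
qed

section \<open>Integrals over half-lines\<close>

text \<open>
  Hake's theorem at infinity: an improper Henstock--Kurzweil integral is already a proper one.
\<close>

lemma has_integral_atLeast_if_tendsto:
  fixes g :: "real \<Rightarrow> 'a::banach"
  assumes g: "\<And>T. g integrable_on {a..T}"
    and lim: "((\<lambda>T. integral {a..T} g) \<longlongrightarrow> l) at_top"
  shows "(g has_integral l) {a..}"
  unfolding has_integral_alt'
proof (intro conjI allI impI)
  have Int: "{a..} \<inter> cbox c d = {max a c..d}" for c d by auto
  have sub: "g integrable_on {max a c..d}" for c d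
    by (rule integrable_on_subinterval[OF g[of d]]) auto
  show "(\<lambda>x. if x \<in> {a..} then g x else 0) integrable_on cbox c d" for c d
    unfolding integrable_restrict_Int Int by (rule sub)
  fix e :: real assume "e > 0"
  then obtain N where N: "\<And>T. T \<ge> N \<Longrightarrow> dist (integral {a..T} g) l < e"
    using lim unfolding tendsto_iff eventually_at_top_linorder by blast
  define B where "B = max 1 (max \<bar>a\<bar> \<bar>N\<bar>) + 1"
  show "\<exists>B>0. \<forall>c d. ball 0 B \<subseteq> cbox c d \<longrightarrow>
      norm (integral (cbox c d) (\<lambda>x. if x \<in> {a..} then g x else 0) - l) < e"
  proof (intro exI conjI allI impI)
    show "B > 0" by (auto simp: B_def)
    fix c d :: real assume "ball 0 B \<subseteq> cbox c d"
    moreover have "- (B - 1) \<in> ball 0 B" "B - 1 \<in> ball 0 B" by (auto simp: B_def)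
    ultimately have "c \<le> a" "d \<ge> N" by (force simp: B_def subset_iff)+
    then show "norm (integral (cbox c d) (\<lambda>x. if x \<in> {a..} then g x else 0) - l) < e"
      using N[of d] unfolding integral_restrict_Int Int by (simp add: dist_norm max_def split: if_splits)
  qed
qed

text \<open>
  Near infinity the primitive is close to the full integral; on the remaining compact interval it
  is bounded because it is continuous.
\<close>

lemma bounded_indefinite_integral_atLeast:
  fixes h :: "real \<Rightarrow> 'a::banach"
  assumes h: "h integrable_on {a..}"
  obtains M where "\<And>T. T \<ge> a \<Longrightarrow> norm (integral {a..T} h) \<le> M"
proof -
  have Int: "{a..} \<inter> cbox c d = {max a c..d}" for c d by auto
  obtain i where "(h has_integral i) {a..}" using h by auto
  then obtain B where B: "\<And>c d. ball 0 B \<subseteq> cbox c d \<Longrightarrow> norm (integral ({a..} \<inter> cbox c d) h - i) < 1"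
    unfolding has_integral_alt' integral_restrict_Int by (meson zero_less_one)
  have far: "norm (integral {a..T} h) \<le> norm i + 1" if "T \<ge> B" for T
  proof -
    have "ball 0 B \<subseteq> cbox (min a (- B)) T" using that by auto
    from B[OF this] show ?thesis
      using norm_triangle_sub[of "integral {a..T} h" i] unfolding Int by (simp add: max_absorb1)
  qed
  have "h integrable_on {a..max a B}"
    by (rule integrable_on_subinterval[OF h]) auto
  then have "bounded ((\<lambda>x. integral {a..x} h) ` {a..max a B})"
    by (intro compact_imp_bounded compact_continuous_image indefinite_integral_continuous_1) auto
  then obtain C where C: "\<And>x. x \<in> {a..max a B} \<Longrightarrow> norm (integral {a..x} h) \<le> C"
    unfolding bounded_iff by (meson imageI)
  show ?thesis
  proof
    fix T assume "T \<ge> a"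
    then show "norm (integral {a..T} h) \<le> max C (norm i + 1)"
      using far[of T] C[of T] by (cases "T \<ge> B") auto
  qed
qed

text \<open>
  A Cauchy criterion that also gives the rate of convergence; since the rate \<open>b\<close> can be
  chosen independently of a parameter of \<open>G\<close>, it yields uniform limits.
\<close>

lemma tendsto_at_top_if_tail_bound:
  fixes G :: "real \<Rightarrow> 'a::banach"
  assumes G: "\<And>S T. a \<le> S \<Longrightarrow> S \<le> T \<Longrightarrow> norm (G T - G S) \<le> b S"
    and b: "(b \<longlongrightarrow> 0) at_top"
  obtains l where "(G \<longlongrightarrow> l) at_top" "\<And>S. a \<le> S \<Longrightarrow> norm (G S - l) \<le> b S"
proof -
  have "Cauchy (\<lambda>n. G (real n))"
  proof (rule CauchyI)
    fix e :: real assume "e > 0"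
    with order_tendstoD(2)[OF b, of "e / 2"] have "eventually (\<lambda>x. b x < e / 2 \<and> x \<ge> a) at_top"
      by (auto intro: eventually_conj eventually_ge_at_top)
    then obtain X where X: "\<And>x. x \<ge> X \<Longrightarrow> b x < e / 2 \<and> x \<ge> a"
      unfolding eventually_at_top_linorder by blast
    obtain N where N: "real N \<ge> X" using real_arch_simple by blast
    show "\<exists>N. \<forall>m\<ge>N. \<forall>n\<ge>N. norm (G (real m) - G (real n)) < e"
    proof (intro exI allI impI)
      fix m n assume "N \<le> m" "N \<le> n"
      then have "norm (G (real m) - G (real N)) \<le> b (real N)" "norm (G (real n) - G (real N)) \<le> b (real N)"
        using X[OF N] by (auto intro!: G)
      then have "norm (G (real m) - G (real n)) \<le> b (real N) + b (real N)"
        by (smt (verit) norm_triangle_ineq4 add_diff_cancel_left' diff_diff_eq2 diff_add_cancel)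
      also have "\<dots> < e" using X[OF N] by simp
      finally show "norm (G (real m) - G (real n)) < e" .
    qed
  qed
  then obtain l where l: "(\<lambda>n. G (real n)) \<longlonglongrightarrow> l"
    using Cauchy_convergent_iff convergent_def by blast
  have bound: "norm (G S - l) \<le> b S" if "a \<le> S" for S
  proof (rule tendsto_upperbound)
    show "(\<lambda>n. norm (G S - G (real n))) \<longlonglongrightarrow> norm (G S - l)"
      by (intro tendsto_intros l)
    obtain N where "real N \<ge> S" using real_arch_simple by blast
    then show "eventually (\<lambda>n. norm (G S - G (real n)) \<le> b S) sequentially"
      unfolding eventually_sequentially
      using G[OF that] by (intro exI[of _ N] allI impI) (smt (verit) norm_minus_commute of_nat_mono)
  qed simp
  moreover have "(G \<longlongrightarrow> l) at_top"
  proof (rule LIM_zero_cancel)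
    show "((\<lambda>x. G x - l) \<longlongrightarrow> 0) at_top"
      by (rule Lim_null_comparison[OF _ b])
         (use bound in \<open>auto intro!: eventually_mono[OF eventually_ge_at_top[of a]]\<close>)
  qed
  ultimately show ?thesis using that by blast
qed

section \<open>Logarithmic kernels\<close>

text \<open>
  The kernel \<open>(1 + lam t) powr (- z / lam)\<close> with \<open>k\<close> logarithmic factors. For \<open>t \<ge> 0\<close> it is the
  factor by which the integrand of the transform of \<open>L ^ k f\<close> at \<open>s0 + z\<close> arises from the
  integrand of the transform of \<open>f\<close> at \<open>s0\<close>.
\<close>

definition log_kernel :: "real \<Rightarrow> nat \<Rightarrow> complex \<Rightarrow> real \<Rightarrow> complex" where
  "log_kernel lam k z t =
     of_real (ln (1 + lam * t)) ^ k * exp (- (z / of_real lam) * of_real (ln (1 + lam * t)))"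

text \<open>
  The derivative of the kernel in \<open>t\<close>. For \<open>k = 0\<close> the term with \<open>k - 1\<close> is multiplied by \<open>0\<close>, so
  truncated subtraction does no harm.
\<close>

definition log_kernel_deriv :: "real \<Rightarrow> nat \<Rightarrow> complex \<Rightarrow> real \<Rightarrow> complex" where
  "log_kernel_deriv lam k z t =
     of_real (lam / (1 + lam * t)) *
       (of_nat k * of_real (ln (1 + lam * t)) ^ (k - 1)
         - z / of_real lam * of_real (ln (1 + lam * t)) ^ k) *
       exp (- (z / of_real lam) * of_real (ln (1 + lam * t)))"

lemma degenerate_kernel_shift:
  assumes "lam > 0" "t \<ge> 0"
  shows "degenerate_kernel lam s t = log_kernel lam 0 (s - s0) t * degenerate_kernel lam s0 t"
proof -
  have u: "1 + lam * t > 0" using assms by (simp add: add_pos_nonneg)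
  then have "degenerate_kernel lam w t = exp (- (w / of_real lam) * of_real (ln (1 + lam * t)))" for w
    unfolding degenerate_kernel_def powr_def using Ln_of_real[OF u] u
    by (simp del: of_real_add of_real_mult)
  then show ?thesis
    by (simp add: log_kernel_def exp_add[symmetric] diff_divide_distrib algebra_simps)
qed

lemma log_kernel_has_vector_derivative:
  assumes "lam > 0" "t \<ge> 0"
  shows "(log_kernel lam k z has_vector_derivative log_kernel_deriv lam k z t) (at t within S)"
proof -
  have u: "1 + lam * t > 0" using assms by (simp add: add_pos_nonneg)
  let ?L = "\<lambda>t. complex_of_real (ln (1 + lam * t))"
  have L: "(?L has_vector_derivative of_real (lam / (1 + lam * t))) (at t within S)"
    using u by (intro has_vector_derivative_of_real)
      (auto intro!: derivative_eq_intros simp: has_real_derivative_iff_has_vector_derivative[symmetric] divide_simps)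
  have "((\<lambda>w. w ^ k * exp (- (z / of_real lam) * w)) has_field_derivative
      (of_nat k * w ^ (k - 1) - z / of_real lam * w ^ k) * exp (- (z / of_real lam) * w)) (at w within T)"
    for w and T :: "complex set"
    using assms by (auto intro!: derivative_eq_intros simp: algebra_simps)
  from field_vector_diff_chain_within[OF L this]
  show ?thesis unfolding log_kernel_def log_kernel_deriv_def o_def by (simp add: mult.assoc)
qed

lemma continuous_on_log_kernel_deriv:
  assumes "lam > 0"
  shows "continuous_on (UNIV \<times> {0..T}) (\<lambda>(z, t). log_kernel_deriv lam k z t)"
proof -
  have "1 + lam * t > 0" if "t \<ge> 0" for t using assms that by (simp add: add_pos_nonneg)
  then have "1 + lam * snd p > 0" if "p \<in> UNIV \<times> {0..T}" for p :: "complex \<times> real"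
    using that by auto
  then have pos: "1 + lam * snd p \<noteq> 0" "complex_of_real (1 + lam * snd p) \<noteq> 0"
    if "p \<in> UNIV \<times> {0..T}" for p :: "complex \<times> real"
    using that by (metis less_irrefl of_real_eq_0_iff)+
  show ?thesis
    unfolding log_kernel_deriv_def case_prod_unfold using assms
    by (intro continuous_intros ballI pos) auto
qed

text \<open>
  Differentiation in \<open>z\<close> commutes with differentiation in \<open>t\<close>: it multiplies the kernel by
  \<open>- L / lam\<close>, that is, it raises the index \<open>k\<close>.
\<close>

lemma log_kernel_deriv_has_field_derivative:
  assumes "lam > 0"
  shows "((\<lambda>z. log_kernel_deriv lam k z t) has_field_derivative
    - (1 / of_real lam) * log_kernel_deriv lam (Suc k) z t) (at z within S)"
proof -
  define L where "L = complex_of_real (ln (1 + lam * t))"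
  define c where "c = complex_of_real (lam / (1 + lam * t))"
  have lam: "complex_of_real lam \<noteq> 0" using assms by simp
  have k: "of_nat k * L ^ (k - 1) * L = of_nat k * L ^ k" by (cases k) auto
  have "((\<lambda>z. c * (of_nat k * L ^ (k - 1) - z / of_real lam * L ^ k) * exp (- (z / of_real lam) * L))
     has_field_derivative
      c * (- (1 / of_real lam * L ^ k)) * exp (- (z / of_real lam) * L)
      + exp (- (z / of_real lam) * L) * (- (1 / of_real lam) * L)
          * (c * (of_nat k * L ^ (k - 1) - z / of_real lam * L ^ k)))
      (at z within S)"
  proof (rule DERIV_mult)
    show "((\<lambda>z. c * (of_nat k * L ^ (k - 1) - z / of_real lam * L ^ k)) has_field_derivative
        c * (- (1 / of_real lam * L ^ k))) (at z within S)"
      using lam by (auto intro!: derivative_eq_intros)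
    show "((\<lambda>z. exp (- (z / of_real lam) * L)) has_field_derivative
        exp (- (z / of_real lam) * L) * (- (1 / of_real lam) * L)) (at z within S)"
      using lam by (auto intro!: derivative_eq_intros)
  qed
  also have "c * (- (1 / of_real lam * L ^ k)) * exp (- (z / of_real lam) * L)
      + exp (- (z / of_real lam) * L) * (- (1 / of_real lam) * L)
          * (c * (of_nat k * L ^ (k - 1) - z / of_real lam * L ^ k))
    = - (1 / of_real lam) * (c * (L ^ k + of_nat k * L ^ (k - 1) * L - z / of_real lam * L ^ Suc k)
        * exp (- (z / of_real lam) * L))"
    by (simp add: algebra_simps)
  finally show ?thesis
    unfolding k log_kernel_deriv_def L_def[symmetric] c_def[symmetric]
    by (simp add: distrib_right add_ac)
qed


section \<open>Truncated transforms\<close>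

lemma truncated_transform_by_parts:
  assumes lam: "lam > 0" and T: "0 \<le> T" and h: "h integrable_on {0..T}"
  shows "((\<lambda>t. log_kernel lam k z t * h t) has_integral
      log_kernel lam k z T * integral {0..T} h
      - integral {0..T} (\<lambda>t. log_kernel_deriv lam k z t * integral {0..t} h)) {0..T}"
    and "(\<lambda>t. log_kernel_deriv lam k z t * integral {0..t} h) integrable_on {0..T}"
proof -
  have "continuous_on {0..T} (\<lambda>t. (\<lambda>(z, t). log_kernel_deriv lam k z t) (z, t))"
    by (rule continuous_on_compose2[OF continuous_on_log_kernel_deriv[OF lam]])
       (auto intro!: continuous_intros)
  then have "continuous_on {0..T} (\<lambda>t. log_kernel_deriv lam k z t)" by simp
  then show int: "(\<lambda>t. log_kernel_deriv lam k z t * integral {0..t} h) integrable_on {0..T}"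
    by (intro integrable_continuous_interval continuous_intros indefinite_integral_continuous_1 h)
  have "((\<lambda>t. log_kernel lam k z t * h t + log_kernel_deriv lam k z t * integral {0..t} h)
      has_integral log_kernel lam k z T * integral {0..T} h) {0..T}"
    using T h by (rule has_integral_product_rule) (auto intro: log_kernel_has_vector_derivative lam)
  from has_integral_diff[OF this integrable_integral[OF int]]
  show "((\<lambda>t. log_kernel lam k z t * h t) has_integral
      log_kernel lam k z T * integral {0..T} h
      - integral {0..T} (\<lambda>t. log_kernel_deriv lam k z t * integral {0..t} h)) {0..T}"
    by simp
qed

text \<open>
  Leibniz's rule requires a continuous integrand, which \<open>log_kernel lam k z t * h t\<close> need not be. It
  applies after integration by parts, where \<open>h\<close> occurs only through its continuous primitive;
  the result is the by-parts form for \<open>Suc k\<close>.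
\<close>

lemma truncated_transform_has_field_derivative:
  assumes lam: "lam > 0" and T: "0 \<le> T" and h: "h integrable_on {0..T}"
  shows "((\<lambda>z. integral {0..T} (\<lambda>t. log_kernel lam k z t * h t)) has_field_derivative
      - (1 / of_real lam) * integral {0..T} (\<lambda>t. log_kernel lam (Suc k) z t * h t)) (at z)"
proof -
  let ?c = "- (1 / complex_of_real lam)"
  let ?H = "\<lambda>t. integral {0..t} h"
  note parts = truncated_transform_by_parts[OF lam T h]
  have "continuous_on (UNIV \<times> {0..T}) (\<lambda>p. ?H (snd p))" for U :: "complex set"
    by (rule continuous_on_compose2[OF indefinite_integral_continuous_1[OF h]])
       (auto intro!: continuous_intros)
  then have "continuous_on (UNIV \<times> cbox 0 T) (\<lambda>(z, t). ?c * log_kernel_deriv lam (Suc k) z t * ?H t)"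
    using continuous_on_log_kernel_deriv[OF lam, of T "Suc k"]
    unfolding case_prod_unfold box_real by (intro continuous_intros)
  then have "((\<lambda>z. integral (cbox 0 T) (\<lambda>t. log_kernel_deriv lam k z t * ?H t)) has_field_derivative
      integral (cbox 0 T) (\<lambda>t. ?c * log_kernel_deriv lam (Suc k) z t * ?H t)) (at z within UNIV)"
    using parts(2) by (intro leibniz_rule_field_derivative DERIV_cmult_right
        log_kernel_deriv_has_field_derivative lam) auto
  then have "((\<lambda>z. integral {0..T} (\<lambda>t. log_kernel_deriv lam k z t * ?H t)) has_field_derivative
      ?c * integral {0..T} (\<lambda>t. log_kernel_deriv lam (Suc k) z t * ?H t)) (at z)"
    by (simp only: box_real mult.assoc integral_mult_right)
  moreover have "((\<lambda>z. log_kernel lam k z T * ?H T) has_field_derivative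
      ?c * (log_kernel lam (Suc k) z T * ?H T)) (at z)"
    unfolding log_kernel_def using lam by (auto intro!: derivative_eq_intros simp: field_simps)
  ultimately have "((\<lambda>z. log_kernel lam k z T * ?H T
        - integral {0..T} (\<lambda>t. log_kernel_deriv lam k z t * ?H t)) has_field_derivative
      ?c * (log_kernel lam (Suc k) z T * ?H T)
        - ?c * integral {0..T} (\<lambda>t. log_kernel_deriv lam (Suc k) z t * ?H t)) (at z)"
    by (rule DERIV_diff[rotated])
  then show ?thesis
    unfolding integral_unique[OF parts(1)] right_diff_distrib .
qed

lemma truncated_transform_higher_deriv:
  assumes lam: "lam > 0" and T: "0 \<le> T" and h: "h integrable_on {0..T}"
  shows "(deriv ^^ k) (\<lambda>s. integral {0..T} (\<lambda>t. log_kernel lam 0 (s - s0) t * h t)) =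
    (\<lambda>s. (- (1 / of_real lam)) ^ k * integral {0..T} (\<lambda>t. log_kernel lam k (s - s0) t * h t))"
proof (induction k)
  case (Suc k)
  have "((\<lambda>s. integral {0..T} (\<lambda>t. log_kernel lam k (s - s0) t * h t)) has_field_derivative
      - (1 / of_real lam) * integral {0..T} (\<lambda>t. log_kernel lam (Suc k) (s - s0) t * h t)) (at s)" for s
    using DERIV_chain2[where g = "\<lambda>s. s - s0" and x = s and Db = 1 and s = UNIV,
        OF truncated_transform_has_field_derivative[OF assms, of k "s - s0"]]
      DERIV_diff[OF DERIV_ident DERIV_const, of s0 s UNIV]
    by simp
  then have "((\<lambda>s. (- (1 / of_real lam)) ^ k * integral {0..T} (\<lambda>t. log_kernel lam k (s - s0) t * h t))
      has_field_derivative (- (1 / of_real lam)) ^ k *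
        (- (1 / of_real lam) * integral {0..T} (\<lambda>t. log_kernel lam (Suc k) (s - s0) t * h t))) (at s)"
    for s
    by (intro DERIV_cmult)
  then show ?case
    by (simp add: Suc.IH fun_eq_iff DERIV_imp_deriv mult.assoc)
qed simp

text \<open>
  With \<open>E t = norm (log_kernel lam 0 z t)\<close>, each of the two boundary terms at \<open>S\<close> and \<open>T\<close> is at
  most \<open>M * E S\<close>, which explains the \<open>2\<close>. The remaining integrand is at most
  \<open>M * norm z / (1 + lam t) * E t\<close>, the derivative of \<open>- M * (norm z / Re z) * E t\<close>, which
  gives the summand \<open>norm z / Re z\<close>.
\<close>

lemma norm_truncated_transform_tail_le:
  fixes h :: "real \<Rightarrow> complex"
  assumes lam: "lam > 0" and ST: "0 \<le> S" "S \<le> T" and h: "h integrable_on {0..T}"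
    and M: "\<And>t. t \<ge> 0 \<Longrightarrow> norm (integral {0..t} h) \<le> M" and z: "Re z > 0"
  shows "norm (integral {0..T} (\<lambda>t. log_kernel lam 0 z t * h t)
             - integral {0..S} (\<lambda>t. log_kernel lam 0 z t * h t))
    \<le> M * (2 + norm z / Re z) * exp (- (Re z / lam) * ln (1 + lam * S))"
proof -
  let ?H = "\<lambda>t. integral {0..t} h"
  define E where "E = (\<lambda>t. exp (- (Re z / lam) * ln (1 + lam * t)))"
  have M0: "M \<ge> 0" using M[of 0] by simp
  have pos: "1 + lam * t > 0" if "t \<ge> 0" for t using lam that by (simp add: add_pos_nonneg)
  have hS: "h integrable_on {0..S}" by (rule integrable_on_subinterval[OF h]) (use ST in auto)
  have normk: "norm (log_kernel lam 0 z t) = E t" for t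
    by (simp add: log_kernel_def E_def norm_exp_eq_Re Re_divide_of_real)
  have normd: "norm (log_kernel_deriv lam 0 z t) = norm z / (1 + lam * t) * E t" if "t \<ge> 0" for t
    using lam pos[OF that]
    by (simp add: log_kernel_deriv_def E_def norm_exp_eq_Re norm_mult norm_divide Re_divide_of_real
        del: of_real_add of_real_mult of_real_divide)
  have E_mono: "E t \<le> E S" if "S \<le> t" for t
  proof -
    have "ln (1 + lam * S) \<le> ln (1 + lam * t)"
      using that lam ST pos[of S] by (intro ln_mono) (auto intro!: mult_left_mono)
    then have "Re z / lam * ln (1 + lam * S) \<le> Re z / lam * ln (1 + lam * t)"
      using lam z by (intro mult_left_mono) auto
    then show ?thesis by (simp add: E_def)
  qed
  have "((\<lambda>t. M * (norm z / (1 + lam * t) * E t)) has_integral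
      (- (M * (norm z / Re z)) * E T) - (- (M * (norm z / Re z)) * E S)) {S..T}"
  proof (rule fundamental_theorem_of_calculus[OF ST(2)])
    fix t assume "t \<in> {S..T}"
    then have u: "1 + lam * t > 0" using ST by (intro pos) auto
    have "(E has_real_derivative E t * (- (Re z / lam) * (lam / (1 + lam * t)))) (at t within {S..T})"
      unfolding E_def using u by (auto intro!: derivative_eq_intros)
    from DERIV_cmult[OF this, of "- (M * (norm z / Re z))"]
    show "((\<lambda>t. - (M * (norm z / Re z)) * E t) has_vector_derivative
        M * (norm z / (1 + lam * t) * E t)) (at t within {S..T})"
      unfolding has_real_derivative_iff_has_vector_derivative[symmetric]
      using lam z u by (simp add: field_simps)
  qed
  note E_int = this
  let ?g = "\<lambda>t. log_kernel_deriv lam 0 z t * ?H t"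
  note parts = truncated_transform_by_parts[OF lam, where h = h and k = 0 and z = z]
  have gT: "?g integrable_on {0..T}" using parts(2) ST h by simp
  have gST: "?g integrable_on {S..T}" by (rule integrable_on_subinterval[OF gT]) (use ST in auto)
  have "norm (integral {S..T} ?g) \<le> integral {S..T} (\<lambda>t. M * (norm z / (1 + lam * t) * E t))"
  proof (rule integral_norm_bound_integral[OF gST has_integral_integrable[OF E_int]])
    fix t assume "t \<in> {S..T}"
    then have t: "t \<ge> 0" using ST by auto
    show "norm (?g t) \<le> M * (norm z / (1 + lam * t) * E t)"
      unfolding norm_mult normd[OF t] mult.commute[of M] using M[OF t] pos[OF t]
      by (intro mult_left_mono) (auto simp: E_def)
  qed
  also have "\<dots> = M * (norm z / Re z) * E S - M * (norm z / Re z) * E T"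
    using integral_unique[OF E_int] by simp
  also have "\<dots> \<le> M * (norm z / Re z) * E S"
    using M0 z by (simp add: E_def)
  finally have tail: "norm (integral {S..T} ?g) \<le> M * (norm z / Re z) * E S" .
  have bdry: "norm (log_kernel lam 0 z t * ?H t) \<le> M * E S" if "t \<ge> S" for t
    unfolding norm_mult normk using M[of t] ST that M0 E_mono[OF that]
    by (subst mult.commute) (auto intro!: mult_mono simp: E_def)
  have "integral {0..T} (\<lambda>t. log_kernel lam 0 z t * h t) - integral {0..S} (\<lambda>t. log_kernel lam 0 z t * h t)
      = log_kernel lam 0 z T * ?H T - log_kernel lam 0 z S * ?H S - integral {S..T} ?g"
    unfolding integral_unique[OF parts(1)[OF order_trans[OF ST] h]] integral_unique[OF parts(1)[OF ST(1) hS]]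
      Henstock_Kurzweil_Integration.integral_combine[OF ST gT, symmetric]
    by simp
  also have "norm \<dots> \<le> M * E S + M * E S + M * (norm z / Re z) * E S"
    by (intro order_trans[OF norm_triangle_ineq4] add_mono bdry tail ST order_refl)
  finally show ?thesis by (simp add: E_def algebra_simps)
qed


lemma truncated_transform_holomorphic:
  assumes lam: "lam > 0" and T: "0 \<le> T" and h: "h integrable_on {0..T}"
  shows "(\<lambda>s. integral {0..T} (\<lambda>t. log_kernel lam k (s - s0) t * h t)) holomorphic_on S"
proof -
  have "(\<lambda>z. integral {0..T} (\<lambda>t. log_kernel lam k z t * h t)) holomorphic_on UNIV"
    using truncated_transform_has_field_derivative[OF assms] holomorphic_on_open[OF open_UNIV] by blast
  then have "(\<lambda>z. integral {0..T} (\<lambda>t. log_kernel lam k z t * h t)) \<circ> (\<lambda>s. s - s0) holomorphic_on S"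
    by (intro holomorphic_on_compose_gen[where t = UNIV] holomorphic_intros) auto
  then show ?thesis by (simp add: o_def)
qed

section \<open>The limit of the truncated transforms\<close>

text \<open>
  On \<open>X\<close> the tail bound is dominated by its value at \<open>Re z = \<delta>\<close>, \<open>norm z = R\<close>, which tends to
  \<open>0\<close> as the truncation point goes to infinity.
\<close>

lemma truncated_transform_uniform_limit:
  fixes h :: "real \<Rightarrow> complex"
  assumes lam: "lam > 0" and h: "h integrable_on {0..}" and \<delta>: "\<delta> > 0"
    and X: "\<And>s. s \<in> X \<Longrightarrow> Re (s - s0) \<ge> \<delta>" "\<And>s. s \<in> X \<Longrightarrow> norm (s - s0) \<le> R"
  shows "uniform_limit X (\<lambda>T s. integral {0..T} (\<lambda>t. log_kernel lam 0 (s - s0) t * h t))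
    (\<lambda>s. integral {0..} (\<lambda>t. log_kernel lam 0 (s - s0) t * h t)) at_top"
proof -
  obtain M where M: "\<And>T. T \<ge> 0 \<Longrightarrow> norm (integral {0..T} h) \<le> M"
    using bounded_indefinite_integral_atLeast[OF h] by blast
  have M0: "M \<ge> 0" using M[of 0] by simp
  have hT: "h integrable_on {0..T}" for T by (rule integrable_on_subinterval[OF h]) auto
  define b where "b = (\<lambda>S. M * (2 + R / \<delta>) * exp (- (\<delta> / lam) * ln (1 + lam * S)))"
  have b: "(b \<longlongrightarrow> 0) at_top"
    unfolding b_def using lam \<delta> by real_asymp
  have close: "norm (integral {0..T} (\<lambda>t. log_kernel lam 0 (s - s0) t * h t)
      - integral {0..} (\<lambda>t. log_kernel lam 0 (s - s0) t * h t)) \<le> b T"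
    if s: "s \<in> X" and T: "T \<ge> 0" for s T
  proof -
    define z where "z = s - s0"
    let ?A = "\<lambda>T. integral {0..T} (\<lambda>t. log_kernel lam 0 z t * h t)"
    have z: "Re z \<ge> \<delta>" "norm z \<le> R" using X[OF s] by (auto simp: z_def)
    have tail: "norm (?A T - ?A S) \<le> b S" if "0 \<le> S" "S \<le> T" for S T
    proof -
      have "norm z / Re z \<le> R / \<delta>"
        using z \<delta> by (intro frac_le) (auto intro: order_trans[OF norm_ge_zero])
      moreover have "exp (- (Re z / lam) * ln (1 + lam * S)) \<le> exp (- (\<delta> / lam) * ln (1 + lam * S))"
        using z lam that by (auto intro!: mult_right_mono divide_right_mono)
      ultimately have "M * (2 + norm z / Re z) * exp (- (Re z / lam) * ln (1 + lam * S)) \<le> b S"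
        unfolding b_def using M0 z \<delta> order_trans[OF norm_ge_zero z(2)]
        by (intro mult_mono) (auto intro!: mult_left_mono mult_nonneg_nonneg add_nonneg_nonneg)
      moreover have "norm (?A T - ?A S) \<le> M * (2 + norm z / Re z) * exp (- (Re z / lam) * ln (1 + lam * S))"
        by (rule norm_truncated_transform_tail_le) (use lam that hT M z \<delta> in auto)
      ultimately show ?thesis by linarith
    qed
    obtain l where l: "(?A \<longlongrightarrow> l) at_top" "\<And>S. 0 \<le> S \<Longrightarrow> norm (?A S - l) \<le> b S"
      using tendsto_at_top_if_tail_bound[OF tail b] by blast
    have "(\<lambda>t. log_kernel lam 0 z t * h t) integrable_on {0..T}" for T
      using truncated_transform_by_parts(1)[OF lam _ hT, of T] by (cases "T \<ge> 0") (auto simp: integrable_on_def)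
    from has_integral_atLeast_if_tendsto[OF this l(1)]
    show ?thesis using l(2)[OF T] unfolding z_def[symmetric] by (simp add: integral_unique)
  qed
  show ?thesis
  proof (rule uniform_limitI)
    fix e :: real assume "e > 0"
    with order_tendstoD(2)[OF b] have "eventually (\<lambda>T. b T < e) at_top" by auto
    then show "\<forall>\<^sub>F T in at_top. \<forall>s\<in>X. dist (integral {0..T} (\<lambda>t. log_kernel lam 0 (s - s0) t * h t))
        (integral {0..} (\<lambda>t. log_kernel lam 0 (s - s0) t * h t)) < e"
      using eventually_ge_at_top[of 0]
      by eventually_elim (use close in \<open>force simp: dist_norm\<close>)
  qed
qed

theorem theorem3p4:
  fixes lam :: real and f :: "real \<Rightarrow> complex" and s s0 :: complex and n :: nat
  assumes "lam > 0"
    and "degenerate_laplace_converges lam f s0"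
    and "Re s0 < Re s"
  shows "degenerate_laplace_converges lam (\<lambda>t. complex_of_real (ln (1 + lam * t)) ^ n * f t) s \<and>
    (\<forall>k<n. (deriv ^^ k) (degenerate_laplace lam f) field_differentiable (at s)) \<and>
    degenerate_laplace lam (\<lambda>t. complex_of_real (ln (1 + lam * t)) ^ n * f t) s =
      (- 1) ^ n * complex_of_real lam ^ n * (deriv ^^ n) (degenerate_laplace lam f) s"
proof -
  note lam = assms(1)
  define h where "h = (\<lambda>t. degenerate_kernel lam s0 t * f t)"
  define A where "A = (\<lambda>k T s. integral {0..T} (\<lambda>t. log_kernel lam k (s - s0) t * h t))"
  let ?F = "degenerate_laplace lam f"
  have h: "h integrable_on {0..}"
    using assms(2) by (simp add: degenerate_laplace_converges_def h_def)
  have hT: "h integrable_on {0..T}" for T by (rule integrable_on_subinterval[OF h]) auto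
  have integrand: "degenerate_kernel lam s' t * (complex_of_real (ln (1 + lam * t)) ^ k * f t) =
      log_kernel lam k (s' - s0) t * h t" if "t \<in> {0..}" for k s' t
    using degenerate_kernel_shift[OF lam, of t s' s0] that by (simp add: h_def log_kernel_def)
  have F: "?F = (\<lambda>s. integral {0..} (\<lambda>t. log_kernel lam 0 (s - s0) t * h t))"
    unfolding degenerate_laplace_def
    using integrand[where k = 0] by (auto intro!: Henstock_Kurzweil_Integration.integral_cong)

  \<comment> \<open>Half the distance from \<open>s\<close> to the line \<open>Re w = Re s0\<close>: the closed disc of this radius stays
    at distance at least \<open>\<delta>\<close> from the line.\<close>
  define \<delta> where "\<delta> = (Re s - Re s0) / 2"
  have \<delta>: "\<delta> > 0" using assms(3) by (simp add: \<delta>_def)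
  have "uniform_limit (cball s \<delta>) (A 0) ?F at_top"
    unfolding A_def F
  proof (rule truncated_transform_uniform_limit[OF lam h \<delta>])
    fix s' assume "s' \<in> cball s \<delta>"
    then have s': "norm (s - s') \<le> \<delta>" by (simp add: dist_norm)
    then show "Re (s' - s0) \<ge> \<delta>"
      using complex_Re_le_cmod[of "s - s'"] by (simp add: \<delta>_def field_simps)
    show "norm (s' - s0) \<le> norm (s - s0) + \<delta>"
      using s' norm_triangle_ineq4[of "s - s0" "s - s'"] by simp
  qed
  note ulim = this
  have holo: "\<forall>\<^sub>F T in at_top. A 0 T holomorphic_on X" for X
    using eventually_ge_at_top[of 0]
    unfolding A_def by eventually_elim (intro truncated_transform_holomorphic lam hT)

  have F_holo: "?F holomorphic_on ball s \<delta>"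
  proof (rule holomorphic_uniform_limit[OF _ ulim])
    show "\<forall>\<^sub>F T in at_top. continuous_on (cball s \<delta>) (A 0 T) \<and> A 0 T holomorphic_on ball s \<delta>"
      using holo[of "cball s \<delta>"] holo[of "ball s \<delta>"]
      by eventually_elim (simp add: holomorphic_on_imp_continuous_on)
  qed auto
  have "(deriv ^^ k) ?F field_differentiable (at s)" for k
    by (rule holomorphic_on_imp_differentiable_at[OF holomorphic_higher_deriv[OF F_holo open_ball] open_ball])
       (use \<delta> in simp)
  moreover have "((\<lambda>t. log_kernel lam n (s - s0) t * h t) has_integral
      (- 1) ^ n * complex_of_real lam ^ n * (deriv ^^ n) ?F s) {0..}"
  proof (rule has_integral_atLeast_if_tendsto)
    show "(\<lambda>t. log_kernel lam n (s - s0) t * h t) integrable_on {0..T}" for T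
      using truncated_transform_by_parts(1)[OF lam _ hT, of T] by (cases "T \<ge> 0") (auto simp: integrable_on_def)
    have "((\<lambda>T. (deriv ^^ n) (A 0 T) s) \<longlongrightarrow> (deriv ^^ n) ?F s) at_top"
      using \<delta> by (intro higher_deriv_complex_uniform_limit[OF
            uniform_limit_on_subset[OF ulim ball_subset_cball] holo _ open_ball]) auto
    then have "((\<lambda>T. (- 1) ^ n * complex_of_real lam ^ n * (deriv ^^ n) (A 0 T) s) \<longlongrightarrow>
        (- 1) ^ n * complex_of_real lam ^ n * (deriv ^^ n) ?F s) at_top"
      by (intro tendsto_mult_left)
    moreover have "\<forall>\<^sub>F T in at_top. (- 1) ^ n * complex_of_real lam ^ n * (deriv ^^ n) (A 0 T) s = A n T s"
      using eventually_ge_at_top[of 0]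
    proof eventually_elim
      case (elim T)
      have "(- 1) ^ n * complex_of_real lam ^ n * (- (1 / complex_of_real lam)) ^ n = 1"
        using lam by (simp add: power_mult_distrib[symmetric])
      then show ?case
        unfolding A_def truncated_transform_higher_deriv[OF lam elim hT] by (simp flip: mult.assoc)
    qed
    ultimately show "((\<lambda>T. integral {0..T} (\<lambda>t. log_kernel lam n (s - s0) t * h t)) \<longlongrightarrow>
        (- 1) ^ n * complex_of_real lam ^ n * (deriv ^^ n) ?F s) at_top"
      unfolding A_def by (rule Lim_transform_eventually)
  qed
  then have "((\<lambda>t. degenerate_kernel lam s t * (complex_of_real (ln (1 + lam * t)) ^ n * f t)) has_integral
      (- 1) ^ n * complex_of_real lam ^ n * (deriv ^^ n) ?F s) {0..}"
    by (rule has_integral_eq[rotated]) (simp add: integrand)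
  ultimately show ?thesis
    unfolding degenerate_laplace_converges_def degenerate_laplace_def[of _ "\<lambda>t. _ t * f t"]
    by (auto simp: integral_unique has_integral_integrable)
qed

end
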